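(* Let $A=[\mathbf{a}_1,\ldots,\mathbf{a}_n]\in\mathbb{Z}_{\ge0}^{d\times n}$ and $B=[\mathbf{b}_1,\ldots,\mathbf{b}_m]\in\mathbb{Z}_{\ge0}^{d\times m}$, with $\mathbf{a}_n=\mathbf{b}_m=\mathbf{0}_d$, be of harmony. Let $K[\mathbf{x}]=K[x_1,\ldots,x_n]$ and $K[\mathbf{y}]=K[y_1,\ldots,y_m]$ be polynomial rings over a field $K$. Suppose that $\mathrm{in}_{<_A}(I_A)\subset K[\mathbf{x}]$ and $\mathrm{in}_{<_B}(I_B)\subset K[\mathbf{y}]$ are squarefree with respect to reverse lexicographic orders $<_A$ on $K[\mathbf{x}]$ and $<_B$ on $K[\mathbf{y}]$ such that: $x_i<_A x_j$ whenever $i\neq j$ and $a_{ki}\le a_{kj}$ for each $1\le k\le d$ (where $\mathbf{a}_i=[a_{1i},\ldots,a_{di}]^\top$); $x_n$ is the smallest variable with respect to $<_A$; and $y_m$ is the smallest variable with respect to $<_B$. Let $[-B,A]^*$ be the $(d+1)\times(n+m+1)$ integer matrix \[\begin{bmatrix}-\mathbf{b}_1&\cdots&-\mathbf{b}_m&\mathbf{a}_1&\cdots&\mathbf{a}_n&\mathbf{0}_d\\-1&\cdots&-1&1&\cdots&1&0\end{bmatrix}.\] Then the toric ideal $I_{[-B,A]^*}$ possesses a squarefree initial ideal with respect to a reverse lexicographic order whose smallest variable corresponds to the column $\mathbf{0}_{d+1}$ of $[-B,A]^*$.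
   Context: For an integer $d\times n$ matrix $A=[\mathbf{a}_1,\ldots,\mathbf{a}_n]$, the toric ring is $K[A]=K[\mathbf{t}^{\mathbf{a}_1}s,\ldots,\mathbf{t}^{\mathbf{a}_n}s]\subset K[t_1^{\pm1},\ldots,t_d^{\pm1},s]$ where $\mathbf{t}^{\mathbf{a}}=t_1^{a_1}\cdots t_d^{a_d}$, and the toric ideal $I_A$ is the kernel of the surjection $K[x_1,\ldots,x_n]\to K[A]$, $x_j\mapsto\mathbf{t}^{\mathbf{a}_j}s$. An initial ideal is squarefree if generated by squarefree monomials. The reverse lexicographic order induced by $x_n<\cdots<x_1$: $x^{a}<x^{b}$ iff $\sum a_i<\sum b_i$, or $\sum a_i=\sum b_i$ and the rightmost nonzero entry of $b-a$ is negative. For $\mathbf{c}\in\mathbb{Z}^d$ let $\mathbf{c}^{(+)},\mathbf{c}^{(-)}\in\mathbb{Z}_{\ge0}^d$ have entries $\max\{0,c_i\}$ and $\max\{0,-c_i\}$. Matrices $A\in\mathbb{Z}_{\ge0}^{d\times n}$, $B\in\mathbb{Z}_{\ge0}^{d\times m}$, each having $\mathbf{0}_d$ as a column, are of harmony if for every column $\mathbf{a}$ of $A$ and column $\mathbf{b}$ of $B$, with $\mathbf{c}=\mathbf{a}-\mathbf{b}$, the vector $\mathbf{c}^{(+)}$ is a column of $A$ and $\mathbf{c}^{(-)}$ is a column of $B$. *)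

theory Defs
  imports "HOL-Analysis.Analysis" "HOL-Library.Poly_Mapping"
begin

text \<open>
  A matrix with rows indexed by \<open>'d\<close> and columns indexed by \<open>'n\<close> is an element of \<open>int^'n^'d\<close>.
  The polynomial ring over the field \<open>'k\<close> with one variable for each element of \<open>'v\<close> is
  \<open>('v \<Rightarrow>\<^sub>0 nat) \<Rightarrow>\<^sub>0 'k\<close> with the convolution product.  The ring
  $K[t_1^{\pm1},\ldots,t_d^{\pm1},s]$ is \<open>((int^'d) \<times> nat) \<Rightarrow>\<^sub>0 'k\<close>: the pair \<open>(a, k)\<close> is the
  exponent of $\mathbf{t}^{\mathbf{a}}s^k$.
\<close>

type_synonym 'v monom = "'v \<Rightarrow>\<^sub>0 nat"
type_synonym ('v, 'k) mpoly = "('v \<Rightarrow>\<^sub>0 nat) \<Rightarrow>\<^sub>0 'k"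
type_synonym ('d, 'k) laurent = "((int^'d) \<times> nat) \<Rightarrow>\<^sub>0 'k"

definition monomial :: "'v monom \<Rightarrow> ('v, 'k::field) mpoly"
  where "monomial u = Poly_Mapping.single u 1"

definition ideal_generated :: "('v, 'k::field) mpoly set \<Rightarrow> ('v, 'k) mpoly set"
  where "ideal_generated S = module.span (*) S"

text \<open>
  The $K$-algebra homomorphism with $x_j \mapsto \mathbf{t}^{\mathbf{a}_j}s$, where
  $\mathbf{a}_j$ is the $j$th column of the matrix.
\<close>

definition toric_hom :: "int^'n^'d \<Rightarrow> ('n, 'k::field) mpoly \<Rightarrow> ('d, 'k) laurent"
  where "toric_hom A f =
    (\<Sum>u\<in>Poly_Mapping.keys f. Poly_Mapping.single 0 (Poly_Mapping.lookup f u) *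
       (\<Prod>j\<in>UNIV. Poly_Mapping.single (column j A, 1) 1 ^ Poly_Mapping.lookup u j))"

definition toric_ideal :: "int^'n^'d \<Rightarrow> ('n, 'k::field) mpoly set"
  where "toric_ideal A = {f. toric_hom A f = 0}"

definition total_degree :: "'v::finite monom \<Rightarrow> nat"
  where "total_degree u = (\<Sum>i\<in>UNIV. Poly_Mapping.lookup u i)"

text \<open>
  Orders are strict relations: \<open>(i, j) \<in> r\<close> means $x_i < x_j$, and \<open>(u, v) \<in> revlex r\<close> means
  $x^u < x^v$.  Writing the variables in decreasing order, the rightmost nonzero entry of $v - u$
  belongs to the \<open>r\<close>-smallest variable whose exponents in \<open>u\<close> and \<open>v\<close> differ.
\<close>

definition revlex :: "'v::finite rel \<Rightarrow> 'v monom rel"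
  where "revlex r = {(u, v). total_degree u < total_degree v \<or>
    total_degree u = total_degree v \<and>
    (\<exists>i. Poly_Mapping.lookup v i < Poly_Mapping.lookup u i \<and>
         (\<forall>j. (j, i) \<in> r \<longrightarrow> Poly_Mapping.lookup u j = Poly_Mapping.lookup v j))}"

definition smallest_variable :: "'v rel \<Rightarrow> 'v \<Rightarrow> bool"
  where "smallest_variable r i \<longleftrightarrow> (\<forall>j. j \<noteq> i \<longrightarrow> (i, j) \<in> r)"

definition is_initial_exponent :: "'v monom rel \<Rightarrow> ('v, 'k::field) mpoly \<Rightarrow> 'v monom \<Rightarrow> bool"
  where "is_initial_exponent R f u \<longleftrightarrow>
    u \<in> Poly_Mapping.keys f \<and> (\<forall>v\<in>Poly_Mapping.keys f. v \<noteq> u \<longrightarrow> (v, u) \<in> R)"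

definition initial_ideal :: "'v monom rel \<Rightarrow> ('v, 'k::field) mpoly set \<Rightarrow> ('v, 'k) mpoly set"
  where "initial_ideal R I =
    ideal_generated {monomial u | u. \<exists>f\<in>I. is_initial_exponent R f u}"

definition squarefree_monom :: "'v monom \<Rightarrow> bool"
  where "squarefree_monom u \<longleftrightarrow> (\<forall>i. Poly_Mapping.lookup u i \<le> 1)"

definition squarefree_monomial_ideal :: "('v, 'k::field) mpoly set \<Rightarrow> bool"
  where "squarefree_monomial_ideal J \<longleftrightarrow>
    (\<exists>U. (\<forall>u\<in>U. squarefree_monom u) \<and> J = ideal_generated (monomial ` U))"

definition pos_part :: "int^'d \<Rightarrow> int^'d"
  where "pos_part c = (\<chi> k. max 0 (c $ k))"

definition neg_part :: "int^'d \<Rightarrow> int^'d"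
  where "neg_part c = (\<chi> k. max 0 (- (c $ k)))"

definition of_harmony :: "int^'n^'d \<Rightarrow> int^'m^'d \<Rightarrow> bool"
  where "of_harmony A B \<longleftrightarrow>
    (\<forall>k j. 0 \<le> A $ k $ j) \<and> (\<forall>k j. 0 \<le> B $ k $ j) \<and>
    0 \<in> columns A \<and> 0 \<in> columns B \<and>
    (\<forall>a\<in>columns A. \<forall>b\<in>columns B.
       pos_part (a - b) \<in> columns A \<and> neg_part (a - b) \<in> columns B)"

text \<open>
  The matrix $[-B,A]^*$.  \<open>Inl k\<close> are the rows of \<open>A\<close> and \<open>B\<close> and \<open>Inr ()\<close> is the additional last
  row; \<open>Inl j\<close> are the columns of \<open>B\<close>, \<open>Inr (Inl j)\<close> the columns of \<open>A\<close>, and \<open>Inr (Inr ())\<close> is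
  the additional zero column.
\<close>

definition star_matrix :: "int^'m^'d \<Rightarrow> int^'n^'d \<Rightarrow> int^('m + 'n + unit)^('d + unit)"
  where "star_matrix B A = (\<chi> i c.
    case c of
      Inl j \<Rightarrow> (case i of Inl k \<Rightarrow> - (B $ k $ j) | Inr _ \<Rightarrow> - 1)
    | Inr (Inl j) \<Rightarrow> (case i of Inl k \<Rightarrow> A $ k $ j | Inr _ \<Rightarrow> 1)
    | Inr (Inr _) \<Rightarrow> 0)"

end

theory Submission
  imports Defs
begin

text \<open>
  An initial monomial of a toric ideal is a monomial that is not the smallest one in its fibre, so
  everything can be phrased in terms of fibres.  Order the variables by $z < x_i < y_j$ and call a
  monomial $x^p y^q z^e$ reduced if $x^p$ and $y^q$ are the smallest monomials of their fibres,
  $x_n y_m$ does not divide it, and no $x_i y_j$ with overlapping supports of $\mathbf{a}_i$ and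
  $\mathbf{b}_j$ divides it.  Harmony and the relation $x_n y_m = z^2$ show that the smallest
  monomial of a fibre is reduced.  Conversely, two reduced monomials in one fibre agree: the
  disjoint supports let one recover $A p$ and $B q$ as the positive and the negative part of
  $A p - B q$.  If the degrees of $p$ and $p'$ differ, say by $k > 0$, then comparing $x^p$ with
  $x^{p'} x_n^k$ and $y^q$ with $y^{q'} y_m^k$ shows that $x_n y_m$ divides $x^p y^q$.
\<close>

section \<open>Monomial ideals\<close>

interpretation mpoly_module: module "(*) :: ('v, 'k::field) mpoly \<Rightarrow> _"
  by unfold_locales (simp_all add: algebra_simps)

text \<open>The polynomials all of whose exponents are multiples of elements of \<open>U\<close>
  form an ideal containing the generators, hence contain the generated ideal. This turns membership
  of a monomial into divisibility, written additively as \<open>w = u + t\<close>.\<close>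

lemma monomial_in_ideal_generated_iff:
  "(monomial w :: ('v, 'k::field) mpoly) \<in> ideal_generated (monomial ` U) \<longleftrightarrow>
     (\<exists>u\<in>U. \<exists>t. w = u + t)"
proof
  let ?S = "{f :: ('v, 'k) mpoly. \<forall>v\<in>Poly_Mapping.keys f. \<exists>u\<in>U. \<exists>t. v = u + t}"
  have "mpoly_module.subspace ?S"
  proof (rule mpoly_module.subspaceI)
    show "0 \<in> ?S" by simp
  next
    fix f g assume "f \<in> ?S" "g \<in> ?S"
    then show "f + g \<in> ?S"
      using Poly_Mapping.keys_add[of f g] by blast
  next
    fix c f assume f: "f \<in> ?S"
    have "\<exists>u\<in>U. \<exists>t. v = u + t" if v: "v \<in> Poly_Mapping.keys (c * f)" for v
    proof -
      obtain a b where "v = a + b" "b \<in> Poly_Mapping.keys f"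
        using keys_mult[of c f] v by blast
      moreover from this f obtain u t where "u \<in> U" "b = u + t" by blast
      ultimately show ?thesis by (metis add.left_commute)
    qed
    then show "c * f \<in> ?S" by blast
  qed
  moreover have "monomial ` U \<subseteq> ?S"
  proof (rule image_subsetI)
    fix u assume "u \<in> U"
    then have "\<exists>u'\<in>U. \<exists>t. u = u' + t"
      by (metis add.right_neutral)
    then show "monomial u \<in> ?S"
      unfolding monomial_def by simp
  qed
  ultimately have "ideal_generated (monomial ` U) \<subseteq> ?S"
    unfolding ideal_generated_def by (intro mpoly_module.span_minimal)
  moreover assume "(monomial w :: ('v, 'k) mpoly) \<in> ideal_generated (monomial ` U)"
  moreover have "w \<in> Poly_Mapping.keys (monomial w :: ('v, 'k) mpoly)"
    by (simp add: monomial_def)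
  ultimately show "\<exists>u\<in>U. \<exists>t. w = u + t" by blast
next
  assume "\<exists>u\<in>U. \<exists>t. w = u + t"
  then obtain u t where "u \<in> U" "w = u + t" by blast
  moreover have "(monomial (u + t) :: ('v, 'k) mpoly) = monomial t * monomial u"
    by (simp add: monomial_def mult_single add.commute)
  ultimately show "(monomial w :: ('v, 'k) mpoly) \<in> ideal_generated (monomial ` U)"
    unfolding ideal_generated_def
    by (metis mpoly_module.span_scale mpoly_module.span_base imageI)
qed

text \<open>An upward closed \<open>M\<close> is exactly the set of exponents of monomials in its
  ideal. Any squarefree generating set therefore lies in \<open>M\<close> and supplies the divisors;
  conversely, if such divisors exist, the squarefree elements of \<open>M\<close> generate.\<close>

lemma squarefree_monomial_ideal_iff:
  assumes up: "\<And>u t. u \<in> M \<Longrightarrow> u + t \<in> M"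
  shows "squarefree_monomial_ideal (ideal_generated (monomial ` M) :: ('v, 'k::field) mpoly set) \<longleftrightarrow>
    (\<forall>u\<in>M. \<exists>w\<in>M. squarefree_monom w \<and> (\<exists>t. u = w + t))" (is "?L \<longleftrightarrow> ?R")
proof
  assume ?L
  then obtain U :: "'v monom set" where U: "\<forall>u\<in>U. squarefree_monom u"
    and eq: "(ideal_generated (monomial ` M) :: ('v, 'k) mpoly set) = ideal_generated (monomial ` U)"
    unfolding squarefree_monomial_ideal_def by blast
  have iff: "(\<exists>u\<in>M. \<exists>t. w = u + t) \<longleftrightarrow> (\<exists>u\<in>U. \<exists>t. w = u + t)" for w
    unfolding monomial_in_ideal_generated_iff[where 'k = 'k, symmetric] eq ..
  show ?R
  proof
    fix u assume "u \<in> M"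
    then obtain w t where w: "w \<in> U" "u = w + t"
      using iff[of u] by (metis add.right_neutral)
    then have "w \<in> M" using iff[of w] up by (metis add.right_neutral)
    with w U show "\<exists>w\<in>M. squarefree_monom w \<and> (\<exists>t. u = w + t)" by blast
  qed
next
  assume R: ?R
  let ?U = "{w \<in> M. squarefree_monom w}"
  have "(monomial ` M :: ('v, 'k) mpoly set) \<subseteq> ideal_generated (monomial ` ?U)"
    using R by (fastforce simp: monomial_in_ideal_generated_iff)
  then have "(ideal_generated (monomial ` M) :: ('v, 'k) mpoly set) \<subseteq> ideal_generated (monomial ` ?U)"
    unfolding ideal_generated_def
    by (intro mpoly_module.span_minimal mpoly_module.subspace_span)
  moreover have "(ideal_generated (monomial ` ?U) :: ('v, 'k) mpoly set) \<subseteq> ideal_generated (monomial ` M)"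
    unfolding ideal_generated_def by (intro mpoly_module.span_mono) blast
  ultimately show ?L
    unfolding squarefree_monomial_ideal_def by (intro exI[of _ ?U]) blast
qed

section \<open>Initial monomials of toric ideals\<close>

lemma total_degree_add [simp]: "total_degree (u + v) = total_degree u + total_degree v"
  by (simp add: total_degree_def lookup_add sum.distrib)

lemma total_degree_single [simp]: "total_degree (Poly_Mapping.single i k) = k"
  by (simp add: total_degree_def lookup_single when_def)

lemma total_degree_zero [simp]: "total_degree 0 = 0"
  by (simp add: total_degree_def)

text \<open>The t-exponent of the image of x^u under the toric map. The s-exponent is
  \<open>total_degree u\<close>, so a fibre consists of the monomials with a given weight and a
  given total degree.\<close>

definition weight :: "int^'n^'d \<Rightarrow> 'n::finite monom \<Rightarrow> int^'d"
  where "weight A u = (\<chi> k. \<Sum>j\<in>UNIV. A $ k $ j * int (Poly_Mapping.lookup u j))"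

lemma weight_add [simp]: "weight A (u + v) = weight A u + weight A v"
  by (simp add: weight_def vec_eq_iff lookup_add sum.distrib algebra_simps)

lemma weight_single: "weight A (Poly_Mapping.single i k) $ l = A $ l $ i * int k"
proof -
  have "(\<Sum>j\<in>UNIV. A $ l $ j * int (Poly_Mapping.lookup (Poly_Mapping.single i k) j)) =
        (\<Sum>j\<in>UNIV. if j = i then A $ l $ i * int k else 0)"
    by (intro sum.cong) (auto simp: lookup_single when_def)
  then show ?thesis by (simp add: weight_def)
qed

lemma prod_single_power:
  fixes A :: "int^'n::finite^'d::finite"
  shows "(\<Prod>j\<in>UNIV. Poly_Mapping.single (column j A, 1::nat) (1::'k::field) ^ Poly_Mapping.lookup u j) =
    Poly_Mapping.single (weight A u, total_degree u) 1"
proof -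
  have vec_add: "(\<chi> l. f l) + (\<chi> l. g l) = (\<chi> l. f l + g l)" for f g :: "'d \<Rightarrow> int"
    by (simp add: vec_eq_iff)
  have pow: "Poly_Mapping.single (a, 1::nat) (1::'k) ^ k = Poly_Mapping.single (\<chi> l. a $ l * int k, k) 1"
    for a :: "int^'d" and k
  proof (induction k)
    case 0
    then show ?case by (simp flip: single_one zero_vec_def zero_prod_def)
  next
    case (Suc k)
    moreover have "a + (\<chi> l. a $ l * int k) = (\<chi> l. a $ l * int (Suc k))"
      by (simp add: vec_eq_iff algebra_simps)
    ultimately show ?case by (simp add: mult_single)
  qed
  have "(\<Prod>j\<in>J. Poly_Mapping.single (column j A, 1::nat) (1::'k) ^ Poly_Mapping.lookup u j) =
    Poly_Mapping.single (\<chi> l. \<Sum>j\<in>J. A $ l $ j * int (Poly_Mapping.lookup u j), 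
      \<Sum>j\<in>J. Poly_Mapping.lookup u j) 1" if "finite J" for J
    using that
  proof (induction J)
    case empty
    then show ?case by (simp flip: single_one zero_vec_def zero_prod_def)
  next
    case (insert x F)
    then show ?case
      by (simp add: pow[simplified] mult_single vec_add column_def)
  qed
  from this[of UNIV] show ?thesis by (simp add: weight_def total_degree_def)
qed

lemma toric_hom_eq:
  "toric_hom A f = (\<Sum>u\<in>Poly_Mapping.keys f.
     Poly_Mapping.single (weight A u, total_degree u) (Poly_Mapping.lookup f u))"
  unfolding toric_hom_def prod_single_power by (simp add: mult_single)

lemma lookup_sum_poly_mapping:
  "Poly_Mapping.lookup (\<Sum>i\<in>I. f i) x = (\<Sum>i\<in>I. Poly_Mapping.lookup (f i) x)"
  by (induction I rule: infinite_finite_induct) (simp_all add: lookup_add)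

definition nonminimal :: "'n rel \<Rightarrow> int^'n^'d \<Rightarrow> 'n::finite monom set"
  where "nonminimal r A = {u. \<exists>v. (v, u) \<in> revlex r \<and>
    total_degree v = total_degree u \<and> weight A v = weight A u}"

lemma revlex_irrefl: "(u, u) \<notin> revlex r"
  by (auto simp: revlex_def)

text \<open>The image of \<open>f\<close> at the bidegree of \<open>u\<close> only collects
  coefficients from the fibre of \<open>u\<close>, so an initial term cannot cancel unless a smaller
  monomial shares its fibre. Conversely, the binomial x^u - x^v lies in the toric ideal.\<close>

lemma ex_initial_exponent_iff:
  "(\<exists>f\<in>(toric_ideal A :: ('n::finite, 'k::field) mpoly set). is_initial_exponent (revlex r) f u) \<longleftrightarrow>
     u \<in> nonminimal r A"
proof
  assume "\<exists>f\<in>(toric_ideal A :: ('n, 'k) mpoly set). is_initial_exponent (revlex r) f u"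
  then obtain f :: "('n, 'k) mpoly" where f: "toric_hom A f = 0" and u: "u \<in> Poly_Mapping.keys f"
    and init: "\<And>v. v \<in> Poly_Mapping.keys f \<Longrightarrow> v \<noteq> u \<Longrightarrow> (v, u) \<in> revlex r"
    unfolding toric_ideal_def is_initial_exponent_def by blast
  show "u \<in> nonminimal r A"
  proof (rule ccontr)
    assume "u \<notin> nonminimal r A"
    \<comment> \<open>All other exponents of \<open>f\<close> are smaller than \<open>u\<close>; if
      \<open>u\<close> is minimal in its fibre, they lie in other fibres and the coefficient at
      \<open>u\<close> survives.\<close>
    then have *: "(weight A v, total_degree v) \<noteq> (weight A u, total_degree u)"
      if "v \<in> Poly_Mapping.keys f" "v \<noteq> u" for v
      using init[OF that] by (auto simp: nonminimal_def)
    have "Poly_Mapping.lookup (toric_hom A f) (weight A u, total_degree u) =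
      (\<Sum>v\<in>Poly_Mapping.keys f. if v = u then Poly_Mapping.lookup f u else 0)"
      unfolding toric_hom_eq lookup_sum_poly_mapping
      using * by (intro sum.cong) (auto simp: lookup_single when_def)
    also have "\<dots> = Poly_Mapping.lookup f u"
      using u by simp
    finally show False
      using f u by (simp add: in_keys_iff)
  qed
next
  assume "u \<in> nonminimal r A"
  then obtain v where v: "(v, u) \<in> revlex r" "total_degree v = total_degree u" "weight A v = weight A u"
    unfolding nonminimal_def by blast
  then have "u \<noteq> v" by (auto simp: revlex_irrefl)
  define f :: "('n, 'k) mpoly" where "f = Poly_Mapping.single u 1 - Poly_Mapping.single v 1"
  have lk: "Poly_Mapping.lookup f w = (if w = u then 1 else if w = v then - 1 else 0)" for w
    using \<open>u \<noteq> v\<close> by (simp add: f_def lookup_minus lookup_single when_def)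
  then have keys: "Poly_Mapping.keys f = {u, v}"
    by (auto simp: in_keys_iff split: if_splits)
  have "toric_hom A f = 0"
    using v \<open>u \<noteq> v\<close> by (simp add: toric_hom_eq keys lk flip: single_add)
  moreover have "is_initial_exponent (revlex r) f u"
    using v by (simp add: is_initial_exponent_def keys)
  ultimately show "\<exists>f\<in>(toric_ideal A :: ('n, 'k) mpoly set). is_initial_exponent (revlex r) f u"
    unfolding toric_ideal_def by blast
qed

lemma revlex_add: "(v, u) \<in> revlex r \<Longrightarrow> (v + t, u + t) \<in> revlex r"
  by (auto simp: revlex_def lookup_add)

lemma nonminimal_add: "u \<in> nonminimal r A \<Longrightarrow> u + t \<in> nonminimal r A"
  unfolding nonminimal_def using revlex_add by fastforce

text \<open>The right-hand side is a purely combinatorial condition on fibres in which the field no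
  longer occurs.\<close>

lemma squarefree_initial_ideal_iff:
  "squarefree_monomial_ideal
     (initial_ideal (revlex r) (toric_ideal A :: ('n::finite, 'k::field) mpoly set)) \<longleftrightarrow>
   (\<forall>u\<in>nonminimal r A. \<exists>w\<in>nonminimal r A. squarefree_monom w \<and> (\<exists>t. u = w + t))"
proof -
  have "{monomial u |u. \<exists>f\<in>(toric_ideal A :: ('n, 'k) mpoly set). is_initial_exponent (revlex r) f u} =
        (monomial ` nonminimal r A :: ('n, 'k) mpoly set)"
    by (auto simp: ex_initial_exponent_iff)
  then show ?thesis
    unfolding initial_ideal_def by (simp add: squarefree_monomial_ideal_iff nonminimal_add)
qed

section \<open>The reverse lexicographic order on a fibre\<close>

lemma strict_linear_order_imp_wf:
  fixes r :: "'v::finite rel"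
  assumes "strict_linear_order r"
  shows "wf r"
  using assms unfolding strict_linear_order_on_def
  by (intro finite_acyclic_wf) (auto simp: acyclic_irrefl)

lemma revlex_total:
  assumes r: "strict_linear_order r" and "total_degree u = total_degree v" "u \<noteq> v"
  shows "(u, v) \<in> revlex r \<or> (v, u) \<in> revlex r"
proof -
  let ?D = "{i. Poly_Mapping.lookup u i \<noteq> Poly_Mapping.lookup v i}"
  have "?D \<noteq> {}" using \<open>u \<noteq> v\<close> by (auto intro: poly_mapping_eqI)
  \<comment> \<open>The smallest variable at which the exponents differ decides the
    comparison.\<close>
  then obtain i where "i \<in> ?D" "\<And>j. (j, i) \<in> r \<Longrightarrow> j \<notin> ?D"
    using strict_linear_order_imp_wf[OF r] by (metis wfE_min all_not_in_conv)
  then have "Poly_Mapping.lookup u i < Poly_Mapping.lookup v i \<or>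
      Poly_Mapping.lookup v i < Poly_Mapping.lookup u i"
    and "\<forall>j. (j, i) \<in> r \<longrightarrow> Poly_Mapping.lookup u j = Poly_Mapping.lookup v j"
    by auto
  then show ?thesis
    unfolding revlex_def mem_Collect_eq case_prod_conv using assms(2) by metis
qed

lemma revlex_trans:
  assumes r: "strict_linear_order r" 
    and "(u, v) \<in> revlex r" "(v, w) \<in> revlex r"
  shows "(u, w) \<in> revlex r"
proof (cases "total_degree u < total_degree v \<or> total_degree v < total_degree w")
  case True
  then show ?thesis using assms by (auto simp: revlex_def)
next
  case False
  then have deg: "total_degree u = total_degree v" "total_degree v = total_degree w"
    using assms by (auto simp: revlex_def)
  obtain i where i: "Poly_Mapping.lookup v i < Poly_Mapping.lookup u i"
    "\<And>j. (j, i) \<in> r \<Longrightarrow> Poly_Mapping.lookup u j = Poly_Mapping.lookup v j"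
    using assms(2) deg by (auto simp: revlex_def)
  obtain i' where i': "Poly_Mapping.lookup w i' < Poly_Mapping.lookup v i'"
    "\<And>j. (j, i') \<in> r \<Longrightarrow> Poly_Mapping.lookup v j = Poly_Mapping.lookup w j"
    using assms(3) deg by (auto simp: revlex_def)
  have tr: "trans r" and "i = i' \<or> (i, i') \<in> r \<or> (i', i) \<in> r"
    using r by (auto simp: strict_linear_order_on_def total_on_def)
  \<comment> \<open>The smaller of the two deciding variables decides between \<open>u\<close> and
    \<open>w\<close>.\<close>
  then consider "i = i'" | "(i, i') \<in> r" | "(i', i) \<in> r" by blast
  then have "\<exists>i. Poly_Mapping.lookup w i < Poly_Mapping.lookup u i \<and>
      (\<forall>j. (j, i) \<in> r \<longrightarrow> Poly_Mapping.lookup u j = Poly_Mapping.lookup w j)"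
  proof cases
    case 1
    then show ?thesis using i i' by (metis order.strict_trans)
  next
    case 2
    then show ?thesis using i i' by (metis transD[OF tr])
  next
    case 3
    then show ?thesis using i i' by (metis transD[OF tr])
  qed
  then show ?thesis using deg by (simp add: revlex_def)
qed

lemma finite_total_degree: "finite {u :: 'v::finite monom. total_degree u = d}"
proof (rule finite_imageD)
  have "Poly_Mapping.lookup u i \<le> total_degree u" for u :: "'v monom" and i
    unfolding total_degree_def by (rule member_le_sum) auto
  then have "Poly_Mapping.lookup ` {u :: 'v monom. total_degree u = d} \<subseteq> (\<Pi>\<^sub>E i\<in>UNIV. {..d})"
    by (auto simp: PiE_def)
  then show "finite (Poly_Mapping.lookup ` {u :: 'v monom. total_degree u = d})"
    by (rule finite_subset) (auto intro: finite_PiE)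
  show "inj_on Poly_Mapping.lookup {u :: 'v monom. total_degree u = d}"
    by (intro inj_onI poly_mapping_eqI) simp
qed

text \<open>A fibre lies in a single degree and is thus finite, and a transitive irreflexive
  relation on a finite set has minimal elements.\<close>

lemma ex_minimal:
  assumes r: "strict_linear_order r"
  shows "\<exists>v. total_degree v = total_degree u \<and> weight A v = weight A u \<and> v \<notin> nonminimal r A"
proof -
  let ?F = "{v. total_degree v = total_degree u \<and> weight A v = weight A u}"
  let ?R = "revlex r \<inter> ?F \<times> ?F"
  have "finite ?F" by (rule finite_subset[OF _ finite_total_degree]) blast
  moreover have "trans ?R" using revlex_trans[OF r] by (intro transI) blast
  then have "acyclic ?R" by (auto simp: acyclic_irrefl irrefl_def revlex_irrefl)
  ultimately have "wf ?R" by (intro finite_acyclic_wf) auto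
  moreover have "u \<in> ?F" by simp
  ultimately obtain v where v: "v \<in> ?F" "\<And>w. (w, v) \<in> ?R \<Longrightarrow> w \<notin> ?F"
    using wfE_min[of ?R u ?F] by blast
  have "v \<notin> nonminimal r A"
  proof
    assume "v \<in> nonminimal r A"
    then obtain w where "(w, v) \<in> revlex r" "w \<in> ?F"
      using v(1) unfolding nonminimal_def by auto
    with v show False by blast
  qed
  with v(1) show ?thesis by blast
qed

lemma minimal_unique:
  assumes "strict_linear_order r" "u \<notin> nonminimal r A" "v \<notin> nonminimal r A"
    "total_degree u = total_degree v" "weight A u = weight A v"
  shows "u = v"
proof (rule ccontr)
  assume "u \<noteq> v"
  from revlex_total[OF assms(1,4) this] show False
    using assms unfolding nonminimal_def by auto
qed

text \<open>Since column \<open>i\<close> is zero, x^v x_i^k lies in the fibre of \<open>u\<close>.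
  If x_i had exponent below \<open>k\<close> in \<open>u\<close>, this product would have the larger
  exponent at the smallest variable and so be smaller than x^u.\<close>

lemma minimal_lookup_smallest:
  assumes "strict_linear_order r" "smallest_variable r i" "column i A = 0"
    and u: "u \<notin> nonminimal r A"
    and deg: "total_degree u = total_degree v + k" and "weight A u = weight A v"
  shows "k \<le> Poly_Mapping.lookup u i"
proof (rule ccontr)
  assume neg: "\<not> k \<le> Poly_Mapping.lookup u i"
  define v' where "v' = v + Poly_Mapping.single i k"
  have "weight A (Poly_Mapping.single i k) = 0"
    using assms(3) by (simp add: vec_eq_iff weight_single column_def)
  then have v': "total_degree v' = total_degree u" "weight A v' = weight A u"
    using assms by (simp_all add: v'_def)
  have lt: "Poly_Mapping.lookup u i < Poly_Mapping.lookup v' i"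
    using neg by (simp add: v'_def lookup_add)
  have "(j, i) \<notin> r" for j
    using assms(1,2) unfolding strict_linear_order_on_def smallest_variable_def
    by (metis irreflD transD)
  then have "(v', u) \<in> revlex r"
    using lt v' by (auto simp: revlex_def)
  with v' u show False by (auto simp: nonminimal_def)
qed

section \<open>The matrix $[-B,A]^*$\<close>

text \<open>The monomial y^q x^p z^e; \<open>q\<close> comes first because the columns of
  \<open>B\<close> precede those of \<open>A\<close>.\<close>

definition star_monom :: "'m::finite monom \<Rightarrow> 'n::finite monom \<Rightarrow> nat \<Rightarrow> ('m + 'n + unit) monom"
  where "star_monom q p e = Abs_poly_mapping
    (case_sum (Poly_Mapping.lookup q) (case_sum (Poly_Mapping.lookup p) (\<lambda>_. e)))"

lemma lookup_Abs_poly_mapping_finite: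
  "Poly_Mapping.lookup (Abs_poly_mapping f :: 'v::finite monom) = f"
  by (simp add: Abs_poly_mapping_inverse)

lemma lookup_star_monom [simp]:
  "Poly_Mapping.lookup (star_monom q p e) (Inl j) = Poly_Mapping.lookup q j"
  "Poly_Mapping.lookup (star_monom q p e) (Inr (Inl i)) = Poly_Mapping.lookup p i"
  "Poly_Mapping.lookup (star_monom q p e) (Inr (Inr x)) = e"
  by (simp_all add: star_monom_def lookup_Abs_poly_mapping_finite)

lemma all_sum3: "(\<forall>c :: 'm + 'n + unit. P c) \<longleftrightarrow>
    (\<forall>j. P (Inl j)) \<and> (\<forall>i. P (Inr (Inl i))) \<and> P (Inr (Inr ()))"
  by (simp add: split_sum_all)

lemma sum3_cases:
  fixes c :: "'m + 'n + unit"
  obtains j where "c = Inl j" | i where "c = Inr (Inl i)" | "c = Inr (Inr ())"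
  using that all_sum3[of "\<lambda>x. x \<noteq> c"] by blast

lemma star_monom_cases:
  obtains q p e where "u = star_monom q p e"
proof
  show "u = star_monom (Abs_poly_mapping (\<lambda>j. Poly_Mapping.lookup u (Inl j)))
      (Abs_poly_mapping (\<lambda>i. Poly_Mapping.lookup u (Inr (Inl i))))
      (Poly_Mapping.lookup u (Inr (Inr ())))"
    by (simp add: poly_mapping_eq_iff fun_eq_iff all_sum3 lookup_Abs_poly_mapping_finite)
qed

lemma star_monom_add: "star_monom q p e + star_monom q' p' e' = star_monom (q + q') (p + p') (e + e')"
  by (simp add: poly_mapping_eq_iff fun_eq_iff all_sum3 lookup_add)

lemma sum_UNIV_sum:
  "(\<Sum>c\<in>(UNIV :: ('a::finite + 'b::finite) set). f c) =
    (\<Sum>j\<in>UNIV. f (Inl j)) + (\<Sum>i\<in>UNIV. f (Inr i))"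
  using sum.Plus[of "UNIV :: 'a set" "UNIV :: 'b set" f] by simp

lemma sum_UNIV_sum3: "(\<Sum>c\<in>(UNIV :: ('m::finite + 'n::finite + unit) set). f c) =
    (\<Sum>j\<in>UNIV. f (Inl j)) + (\<Sum>i\<in>UNIV. f (Inr (Inl i))) + f (Inr (Inr ()))"
  by (simp add: sum_UNIV_sum UNIV_unit add.assoc)

lemma total_degree_star_monom [simp]:
  "total_degree (star_monom q p e) = total_degree q + total_degree p + e"
  by (simp add: total_degree_def sum_UNIV_sum3)

text \<open>The last row of the matrix records the difference of the degrees in x and y, and its
  zero column makes \<open>e\<close> invisible to the weight.\<close>

lemma weight_star_monom_eq_iff:
  "weight (star_matrix B A) (star_monom q p e) = weight (star_matrix B A) (star_monom q' p' e') \<longleftrightarrow>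
    weight A p - weight B q = weight A p' - weight B q' \<and>
    int (total_degree p) - int (total_degree q) = int (total_degree p') - int (total_degree q')"
proof -
  have Inl: "weight (star_matrix B A) (star_monom q p e) $ Inl k = (weight A p - weight B q) $ k"
    for q p e k
    by (simp add: weight_def star_matrix_def sum_UNIV_sum3 sum_negf)
  have Inr: "weight (star_matrix B A) (star_monom q p e) $ Inr x =
      int (total_degree p) - int (total_degree q)" for q p e x
    by (simp add: weight_def star_matrix_def sum_UNIV_sum3 sum_negf total_degree_def)
  have all: "(\<forall>c. P c) \<longleftrightarrow> (\<forall>k. P (Inl k)) \<and> P (Inr ())" for P :: "'a + unit \<Rightarrow> bool"
    by (simp add: split_sum_all)
  show ?thesis
    unfolding vec_eq_iff all Inl Inr by simp
qed

text \<open>With z lowest, z^2 lies below x_n y_m. With every x_i below every y_j, exchanging x_i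
  y_j for another such product with a different x-variable is decided among the x-variables,
  whatever \<open>rB\<close> says.\<close>

definition star_order :: "'m rel \<Rightarrow> 'n rel \<Rightarrow> ('m + 'n + unit) rel"
  where "star_order rB rA = {(c, c'). case c of
      Inl j \<Rightarrow> (case c' of Inl j' \<Rightarrow> (j, j') \<in> rB | Inr _ \<Rightarrow> False)
    | Inr (Inl i) \<Rightarrow> (case c' of Inl _ \<Rightarrow> True | Inr (Inl i') \<Rightarrow> (i, i') \<in> rA | Inr (Inr _) \<Rightarrow> False)
    | Inr (Inr _) \<Rightarrow> c' \<noteq> Inr (Inr ())}"

lemma star_order_simps [simp]:
  "(Inl j, Inl j') \<in> star_order rB rA \<longleftrightarrow> (j, j') \<in> rB"
  "(Inl j, Inr c) \<notin> star_order rB rA"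
  "(Inr (Inl i), Inl j) \<in> star_order rB rA"
  "(Inr (Inl i), Inr (Inl i')) \<in> star_order rB rA \<longleftrightarrow> (i, i') \<in> rA"
  "(Inr (Inl i), Inr (Inr x)) \<notin> star_order rB rA"
  "(Inr (Inr x), c') \<in> star_order rB rA \<longleftrightarrow> c' \<noteq> Inr (Inr ())"
  by (simp_all add: star_order_def)

lemma strict_linear_order_star_order:
  assumes "strict_linear_order rB" "strict_linear_order rA"
  shows "strict_linear_order (star_order rB rA)"
proof -
  have "trans rB" "trans rA" using assms by (auto simp: strict_linear_order_on_def)
  then have "trans (star_order rB rA)"
    unfolding trans_def all_sum3 by simp
  moreover have "irrefl (star_order rB rA)" "total (star_order rB rA)"
    using assms by (simp_all add: irrefl_def total_on_def all_sum3 strict_linear_order_on_def)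
  ultimately show ?thesis by (simp add: strict_linear_order_on_def)
qed

section \<open>Initial monomials coming from \<open>A\<close> and from \<open>B\<close>\<close>

lemma nonminimal_starI:
  assumes "total_degree q' + total_degree p' + e' = total_degree q + total_degree p + e"
    and "weight A p' - weight B q' = weight A p - weight B q"
    and "int (total_degree p') - int (total_degree q') = int (total_degree p) - int (total_degree q)"
    and "Poly_Mapping.lookup (star_monom q p e) c < Poly_Mapping.lookup (star_monom q' p' e') c"
    and "\<And>c'. (c', c) \<in> star_order rB rA \<Longrightarrow>
      Poly_Mapping.lookup (star_monom q' p' e') c' = Poly_Mapping.lookup (star_monom q p e) c'"
  shows "star_monom q p e \<in> nonminimal (star_order rB rA) (star_matrix B A)"
proof -
  have "(star_monom q' p' e', star_monom q p e) \<in> revlex (star_order rB rA)"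
    using assms by (auto simp: revlex_def)
  then show ?thesis
    using assms(1-3) weight_star_monom_eq_iff[of B A q' p' e' q p e]
    unfolding nonminimal_def by force
qed

lemma nonminimalE:
  assumes "u \<in> nonminimal r A"
  obtains v i where "total_degree v = total_degree u" "weight A v = weight A u"
    "Poly_Mapping.lookup u i < Poly_Mapping.lookup v i"
    "\<And>j. (j, i) \<in> r \<Longrightarrow> Poly_Mapping.lookup v j = Poly_Mapping.lookup u j"
  using assms unfolding nonminimal_def revlex_def by auto

text \<open>The comparison of x^p with a smaller x^p' carries over: besides x-variables, only z lies
  below x_i, and it occurs in neither monomial.\<close>

lemma nonminimal_star_A:
  assumes "p \<in> nonminimal rA A"
  shows "star_monom 0 p 0 \<in> nonminimal (star_order rB rA) (star_matrix B A)"
proof -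
  from assms obtain p' i where p': "total_degree p' = total_degree p" "weight A p' = weight A p"
    "Poly_Mapping.lookup p i < Poly_Mapping.lookup p' i"
    "\<And>j. (j, i) \<in> rA \<Longrightarrow> Poly_Mapping.lookup p' j = Poly_Mapping.lookup p j"
    using nonminimalE by metis
  have "Poly_Mapping.lookup (star_monom 0 p' 0) c = Poly_Mapping.lookup (star_monom 0 p 0) c"
    if "(c, Inr (Inl i)) \<in> star_order rB rA" for c
    using that by (cases c rule: sum3_cases) (auto simp: p')
  then show ?thesis
    by (intro nonminimal_starI[of 0 p' 0 _ _ _ _ _ "Inr (Inl i)"]) (simp_all add: p')
qed

text \<open>Here z and all x-variables lie below y_j, but none of them occurs in either
  monomial.\<close>

lemma nonminimal_star_B:
  assumes "q \<in> nonminimal rB B"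
  shows "star_monom q 0 0 \<in> nonminimal (star_order rB rA) (star_matrix B A)"
proof -
  from assms obtain q' j where q': "total_degree q' = total_degree q" "weight B q' = weight B q"
    "Poly_Mapping.lookup q j < Poly_Mapping.lookup q' j"
    "\<And>l. (l, j) \<in> rB \<Longrightarrow> Poly_Mapping.lookup q' l = Poly_Mapping.lookup q l"
    using nonminimalE by metis
  have "Poly_Mapping.lookup (star_monom q' 0 0) c = Poly_Mapping.lookup (star_monom q 0 0) c"
    if "(c, Inl j) \<in> star_order rB rA" for c
    using that by (cases c rule: sum3_cases) (auto simp: q')
  then show ?thesis
    by (intro nonminimal_starI[of q' 0 0 _ _ _ _ _ "Inl j"]) (simp_all add: q')
qed

lemma squarefree_single: "squarefree_monom (Poly_Mapping.single i 1)"
  by (simp add: squarefree_monom_def lookup_single when_def)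

lemma squarefree_zero: "squarefree_monom 0"
  by (simp add: squarefree_monom_def)

lemma squarefree_star_monom:
  "squarefree_monom (star_monom q p e) \<longleftrightarrow> squarefree_monom q \<and> squarefree_monom p \<and> e \<le> 1"
  by (auto simp: squarefree_monom_def all_sum3)

lemma single_add_minus:
  fixes p :: "'v monom"
  assumes "0 < Poly_Mapping.lookup p i"
  shows "p = Poly_Mapping.single i 1 + (p - Poly_Mapping.single i 1)"
  using assms by (intro poly_mapping_eqI) (auto simp: lookup_add lookup_minus lookup_single when_def)

section \<open>Initial monomials forced by harmony\<close>

locale harmony_pair =
  fixes A :: "int^'n::finite^'d::finite" and B :: "int^'m::finite^'d"
    and n :: 'n and m :: 'm and rA :: "'n rel" and rB :: "'m rel"
  assumes column_n: "column n A = 0" and column_m: "column m B = 0"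
    and harmony: "of_harmony A B"
    and rA: "strict_linear_order rA" and rB: "strict_linear_order rB"
    and rA_mono: "\<And>i j. i \<noteq> j \<Longrightarrow> (\<forall>k. A $ k $ i \<le> A $ k $ j) \<Longrightarrow> (i, j) \<in> rA"
    and n_smallest: "smallest_variable rA n" and m_smallest: "smallest_variable rB m"
begin

abbreviation M :: "('m + 'n + unit) monom set"
  where "M \<equiv> nonminimal (star_order rB rA) (star_matrix B A)"

definition reduced :: "'m monom \<Rightarrow> 'n monom \<Rightarrow> bool"
  where "reduced q p \<longleftrightarrow> p \<notin> nonminimal rA A \<and> q \<notin> nonminimal rB B \<and>
    (Poly_Mapping.lookup p n = 0 \<or> Poly_Mapping.lookup q m = 0) \<and>
    (\<forall>k i j. 0 < Poly_Mapping.lookup p i \<longrightarrow> 0 < Poly_Mapping.lookup q j \<longrightarrow>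
      A $ k $ i = 0 \<or> B $ k $ j = 0)"

lemma nonneg: "0 \<le> A $ k $ i" "0 \<le> B $ k $ j"
  using harmony by (auto simp: of_harmony_def)

text \<open>Both columns vanish and the entries 1 and -1 of the last row cancel, so z^2 has the
  weight and the degree of x_n y_m. It is smaller because z is the smallest variable.\<close>

lemma nonminimal_unit: "star_monom (Poly_Mapping.single m 1) (Poly_Mapping.single n 1) 0 \<in> M"
proof (rule nonminimal_starI[of 0 0 2 _ _ _ _ _ "Inr (Inr ())"])
  have "weight A (Poly_Mapping.single n 1) = 0" "weight B (Poly_Mapping.single m 1) = 0"
    using column_n column_m by (auto simp: vec_eq_iff weight_single column_def)
  then show "weight A 0 - weight B 0 =
      weight A (Poly_Mapping.single n 1) - weight B (Poly_Mapping.single m 1)"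
    by (simp add: weight_def vec_eq_iff)
next
  fix c assume "(c, Inr (Inr ())) \<in> star_order rB rA"
  then show "Poly_Mapping.lookup (star_monom 0 0 2) c =
      Poly_Mapping.lookup (star_monom (Poly_Mapping.single m 1) (Poly_Mapping.single n 1) 0) c"
    by (cases c rule: sum3_cases) auto
qed (simp_all add: del: One_nat_def)

text \<open>Harmony replaces the two columns by the positive and negative part of their difference
  \<open>c\<close>, which has the same difference. The resulting x_i' y_j' is smaller, as
  cancellation in row \<open>k\<close> makes x_i' a variable strictly below x_i.\<close>

lemma nonminimal_overlap:
  assumes "A $ k $ i \<noteq> 0" "B $ k $ j \<noteq> 0"
  shows "star_monom (Poly_Mapping.single j 1) (Poly_Mapping.single i 1) 0 \<in> M"
proof -
  define c where "c = column i A - column j B"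
  have "pos_part c \<in> columns A" "neg_part c \<in> columns B"
    using harmony unfolding c_def of_harmony_def columns_def by blast+
  then obtain i' j' where i': "column i' A = pos_part c" and j': "column j' B = neg_part c"
    unfolding columns_def by force
  have A': "A $ l $ i' = max 0 (A $ l $ i - B $ l $ j)" for l
    using i' by (simp add: c_def vec_eq_iff column_def pos_part_def)
  have B': "B $ l $ j' = max 0 (B $ l $ j - A $ l $ i)" for l
    using j' by (simp add: c_def vec_eq_iff column_def neg_part_def)
  have "i' \<noteq> i"
    \<comment> \<open>Both entries in row \<open>k\<close> are positive, so column \<open>i'\<close>
      is strictly smaller there than column \<open>i\<close>.\<close>
    using A'[of k] assms nonneg(1)[of k i] nonneg(2)[of k j] by auto
  moreover have "A $ l $ i' \<le> A $ l $ i" for l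
    using A'[of l] nonneg(1)[of l i] nonneg(2)[of l j] by auto
  ultimately have less: "(i', i) \<in> rA" by (intro rA_mono) auto
  \<comment> \<open>Hence no variable below x_i' occurs in either product, and x_i' itself
    decides.\<close>
  have "l \<noteq> i \<and> l \<noteq> i'" if "(l, i') \<in> rA" for l
    using that less rA unfolding strict_linear_order_on_def by (metis irreflD transD)
  then have "Poly_Mapping.lookup (star_monom (Poly_Mapping.single j' 1) (Poly_Mapping.single i' 1) 0) x =
      Poly_Mapping.lookup (star_monom (Poly_Mapping.single j 1) (Poly_Mapping.single i 1) 0) x"
    if "(x, Inr (Inl i')) \<in> star_order rB rA" for x
    using that by (cases x rule: sum3_cases) (auto simp: lookup_single when_def)
  moreover have "weight A (Poly_Mapping.single i' 1) - weight B (Poly_Mapping.single j' 1) =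
      weight A (Poly_Mapping.single i 1) - weight B (Poly_Mapping.single j 1)"
    by (auto simp: vec_eq_iff weight_single A' B')
  ultimately show ?thesis
    using \<open>i' \<noteq> i\<close>
    by (intro nonminimal_starI[of "Poly_Mapping.single j' 1" "Poly_Mapping.single i' 1" 0
          _ _ _ _ _ "Inr (Inl i')"]) (simp_all add: lookup_single)
qed

section \<open>Uniqueness of reduced monomials in a fibre\<close>

lemma weight_nonneg: "0 \<le> weight A p $ k" "0 \<le> weight B q $ k"
  by (auto simp: weight_def nonneg intro: sum_nonneg)

text \<open>If some variable of x^p has a nonzero entry in row \<open>k\<close>, disjointness of
  supports kills row \<open>k\<close> for every variable of y^q; otherwise the sum for
  \<open>p\<close> is zero termwise.\<close>

lemma reduced_weight:
  assumes "reduced q p"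
  shows "weight A p $ k = 0 \<or> weight B q $ k = 0"
proof (cases "\<exists>i. 0 < Poly_Mapping.lookup p i \<and> A $ k $ i \<noteq> 0")
  case True
  with assms have "B $ k $ j * int (Poly_Mapping.lookup q j) = 0" for j
    unfolding reduced_def by (metis gr0I mult_eq_0_iff of_nat_0)
  then show ?thesis by (simp add: weight_def del: mult_eq_0_iff)
next
  case False
  then have "A $ k $ i * int (Poly_Mapping.lookup p i) = 0" for i
    by (metis gr0I mult_eq_0_iff of_nat_0)
  then show ?thesis by (simp add: weight_def del: mult_eq_0_iff)
qed

lemma reduced_same_fibre:
  assumes red: "reduced q p" "reduced q' p'"
    and diff: "weight A p - weight B q = weight A p' - weight B q'"
    and deg: "int (total_degree p) - int (total_degree q) = int (total_degree p') - int (total_degree q')"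
    and le: "total_degree p' \<le> total_degree p"
  shows "p = p' \<and> q = q'"
proof -
  \<comment> \<open>Two nonnegative numbers, one of which is zero, are determined by their
    difference.\<close>
  have "weight A p $ k = weight A p' $ k \<and> weight B q $ k = weight B q' $ k" for k
  proof -
    have "weight A p $ k - weight B q $ k = weight A p' $ k - weight B q' $ k"
      using diff by (simp add: vec_eq_iff)
    then show ?thesis
      using reduced_weight[OF red(1), of k] reduced_weight[OF red(2), of k]
        weight_nonneg(1)[of p k] weight_nonneg(1)[of p' k]
        weight_nonneg(2)[of q k] weight_nonneg(2)[of q' k] by linarith
  qed
  then have w: "weight A p = weight A p'" "weight B q = weight B q'"
    by (auto simp: vec_eq_iff)
  \<comment> \<open>The last row forces the same excess \<open>k\<close> in x and in y, so x_n^k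
    divides x^p and y_m^k divides y^q.\<close>
  obtain k where k: "total_degree p = total_degree p' + k" using le le_Suc_ex by blast
  with deg have k': "total_degree q = total_degree q' + k" by linarith
  have "k \<le> Poly_Mapping.lookup p n"
    using red(1) k w by (intro minimal_lookup_smallest[OF rA n_smallest column_n])
      (auto simp: reduced_def)
  moreover have "k \<le> Poly_Mapping.lookup q m"
    using red(1) k' w by (intro minimal_lookup_smallest[OF rB m_smallest column_m])
      (auto simp: reduced_def)
  ultimately have "k = 0" using red(1) by (auto simp: reduced_def)
  then show ?thesis
    using red k k' w minimal_unique[OF rA, of p A p'] minimal_unique[OF rB, of q B q']
    by (simp add: reduced_def)
qed

lemma reduced_unique:
  assumes "reduced q p" "reduced q' p'"
    and "weight (star_matrix B A) (star_monom q p e) = weight (star_matrix B A) (star_monom q' p' e')"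
    and "total_degree (star_monom q p e) = total_degree (star_monom q' p' e')"
  shows "star_monom q p e = star_monom q' p' e'"
proof -
  \<comment> \<open>The two monomials play symmetric roles, so either may have the larger x-degree;
    the total degree then determines the exponent of z.\<close>
  have "p = p' \<and> q = q'"
    using reduced_same_fibre[of q p q' p'] reduced_same_fibre[of q' p' q p] assms(1-3)
    by (cases "total_degree p' \<le> total_degree p") (simp_all add: weight_star_monom_eq_iff)
  with assms(4) show ?thesis by simp
qed

section \<open>Squarefree divisors of initial monomials\<close>

lemma squarefree_star_initial:
  assumes sfA: "\<And>p. p \<in> nonminimal rA A \<Longrightarrow> \<exists>w\<in>nonminimal rA A. squarefree_monom w \<and> (\<exists>t. p = w + t)"
    and sfB: "\<And>q. q \<in> nonminimal rB B \<Longrightarrow> \<exists>w\<in>nonminimal rB B. squarefree_monom w \<and> (\<exists>t. q = w + t)"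
    and u: "u \<in> M"
  shows "\<exists>w\<in>M. squarefree_monom w \<and> (\<exists>t. u = w + t)"
proof -
  have not_reduced: "\<exists>w\<in>M. squarefree_monom w \<and> (\<exists>t. star_monom q p e = w + t)"
    if "\<not> reduced q p" for q p e
  proof -
    \<comment> \<open>The divisors found are all free of z, so the power z^e goes into the
      cofactor.\<close>
    have divisor: ?thesis
      if "star_monom q0 p0 0 \<in> M" "squarefree_monom q0" "squarefree_monom p0"
        "q = q0 + q1" "p = p0 + p1" for q0 q1 p0 p1
    proof (intro bexI[of _ "star_monom q0 p0 0"] conjI exI)
      show "star_monom q p e = star_monom q0 p0 0 + star_monom q1 p1 e"
        using that by (simp add: star_monom_add)
    qed (use that in \<open>simp_all add: squarefree_star_monom\<close>)
    have pair: ?thesis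
      if "star_monom (Poly_Mapping.single j 1) (Poly_Mapping.single i 1) 0 \<in> M"
        "0 < Poly_Mapping.lookup p i" "0 < Poly_Mapping.lookup q j" for i j
      by (rule divisor[OF that(1) squarefree_single squarefree_single
            single_add_minus[OF that(3)] single_add_minus[OF that(2)]])
    \<comment> \<open>Each way of failing to be reduced yields a squarefree initial divisor: from
      \<open>A\<close>, from \<open>B\<close>, x_n y_m, or an overlapping x_i y_j.\<close>
    consider "p \<in> nonminimal rA A" | "q \<in> nonminimal rB B"
      | "0 < Poly_Mapping.lookup p n" "0 < Poly_Mapping.lookup q m"
      | k i j where "0 < Poly_Mapping.lookup p i" "0 < Poly_Mapping.lookup q j"
          "A $ k $ i \<noteq> 0" "B $ k $ j \<noteq> 0"
      using \<open>\<not> reduced q p\<close> unfolding reduced_def by (auto simp: neq0_conv)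
    then show ?thesis
    proof cases
      case 1
      then show ?thesis
        using sfA[of p] divisor[OF nonminimal_star_A squarefree_zero, of _ q]
        by (metis add_0_left)
    next
      case 2
      then show ?thesis
        using sfB[of q] divisor[OF nonminimal_star_B _ squarefree_zero, of _ _ p]
        by (metis add_0_left)
    next
      case 3
      then show ?thesis using pair[OF nonminimal_unit] by blast
    next
      case 4
      then show ?thesis using pair[OF nonminimal_overlap] by blast
    qed
  qed
  obtain q p e where u_eq: "u = star_monom q p e" by (rule star_monom_cases)
  \<comment> \<open>The minimum \<open>v\<close> of the fibre of \<open>u\<close> is reduced,
    because a multiple of an initial monomial is initial. Since \<open>u\<close> differs from
    \<open>v\<close>, uniqueness shows that \<open>u\<close> is not reduced.\<close>
  obtain v where v: "total_degree v = total_degree u"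
      "weight (star_matrix B A) v = weight (star_matrix B A) u" "v \<notin> M"
    using ex_minimal[OF strict_linear_order_star_order[OF rB rA]] by blast
  obtain q' p' e' where v_eq: "v = star_monom q' p' e'" by (rule star_monom_cases)
  have "reduced q' p'"
  proof (rule ccontr)
    assume "\<not> reduced q' p'"
    then obtain w t where "w \<in> M" "v = w + t" using not_reduced v_eq by blast
    with v(3) show False using nonminimal_add by blast
  qed
  moreover have "u \<noteq> v" using u v(3) by blast
  ultimately have "\<not> reduced q p"
    using reduced_unique[of q p q' p' e e'] v u_eq v_eq by metis
  then show ?thesis unfolding u_eq by (rule not_reduced)
qed

end

theorem theorem2p1:
  fixes A :: "int^'n::finite^'d::finite"
    and B :: "int^'m::finite^'d"
    and n :: 'n
    and m :: 'm
    and rA :: "'n rel"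
    and rB :: "'m rel"
  assumes "column n A = 0"
    and "column m B = 0"
    and "of_harmony A B"
    and "strict_linear_order rA"
    and "strict_linear_order rB"
    and "squarefree_monomial_ideal
           (initial_ideal (revlex rA) (toric_ideal A :: ('n, 'k::field) mpoly set))"
    and "squarefree_monomial_ideal
           (initial_ideal (revlex rB) (toric_ideal B :: ('m, 'k) mpoly set))"
    and "\<And>i j. i \<noteq> j \<Longrightarrow> (\<forall>k. A $ k $ i \<le> A $ k $ j) \<Longrightarrow> (i, j) \<in> rA"
    and "smallest_variable rA n"
    and "smallest_variable rB m"
  shows "\<exists>r :: ('m + 'n + unit) rel.
           strict_linear_order r \<and>
           smallest_variable r (Inr (Inr ())) \<and>
           squarefree_monomial_ideal
             (initial_ideal (revlex r)
               (toric_ideal (star_matrix B A) :: ('m + 'n + unit, 'k) mpoly set))"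
proof -
  interpret harmony_pair A B n m rA rB
    by (rule harmony_pair.intro) (use assms in auto)
  have "\<exists>w\<in>M. squarefree_monom w \<and> (\<exists>t. u = w + t)" if "u \<in> M" for u
    using assms(6,7) that unfolding squarefree_initial_ideal_iff
    by (intro squarefree_star_initial) auto
  then have "squarefree_monomial_ideal
      (initial_ideal (revlex (star_order rB rA))
        (toric_ideal (star_matrix B A) :: ('m + 'n + unit, 'k) mpoly set))"
    unfolding squarefree_initial_ideal_iff by blast
  moreover have "smallest_variable (star_order rB rA) (Inr (Inr ()))"
    by (simp add: smallest_variable_def)
  ultimately show ?thesis
    using strict_linear_order_star_order[OF rB rA] by blast
qed

end
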